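(* Let $\mathbb G=(\mathcal V,\mathcal E)$ be an undirected graph with node set $\mathcal V=\{1,\dots,N\}$ and Laplacian matrix $L_N$. Let $\mathcal S\subset\mathcal V$ be a set of $l$ controlled nodes ($1\le l<N$), arbitrarily chosen from $\mathcal V$. Then $$\lambda_1(L(\mathcal S|\mathcal S))\le \lambda_{l+1}(L_N).$$
   Context: Graphs have no self-loops or multiple edges. The Laplacian matrix $L_N=[l_{ij}]_{N\times N}$ of an undirected graph $\mathbb G$ is defined by: for $i\ne j$, $l_{ij}=-1$ if there is an edge between $i$ and $j$ and $l_{ij}=0$ otherwise; $l_{ii}=-\sum_{j\neq i}l_{ij}$. For $\mathcal S\subset\mathcal V$ with $|\mathcal S|=l$, $L(\mathcal S|\mathcal S)$ denotes the $(N-l)\times(N-l)$ principal submatrix of $L_N$ obtained by deleting the rows and columns corresponding to the nodes in $\mathcal S$ (the grounded Laplacian). For a real symmetric $n\times n$ matrix $M$, the eigenvalues counted with multiplicity are ordered as $\lambda_n(M)\ge\lambda_{n-1}(M)\ge\dots\ge\lambda_1(M)$, so $\lambda_1(M)$ is the smallest eigenvalue. *)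

theory Defs
  imports
    "Graph_Theory.Pair_Digraph"
    "Jordan_Normal_Form.Char_Poly"
    "Jordan_Normal_Form.DL_Submatrix"
begin

text \<open>
  An undirected graph without loops or multiple edges is a \<^locale>\<open>pair_graph\<close>: an edge between
  \<open>u\<close> and \<open>v\<close> is the pair of arcs \<open>(u, v)\<close> and \<open>(v, u)\<close>.  Nodes are \<open>1, \<dots>, N\<close>, whereas
  matrix indices start at \<open>0\<close>, so node \<open>v\<close> belongs to row and column \<open>v - 1\<close>.
\<close>

definition laplacian_offdiag :: "nat pair_pre_digraph \<Rightarrow> nat \<Rightarrow> nat \<Rightarrow> real" where
  "laplacian_offdiag G u v = (if (u, v) \<in> parcs G then - 1 else 0)"

definition laplacian :: "nat \<Rightarrow> nat pair_pre_digraph \<Rightarrow> real mat" where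
  "laplacian N G = mat N N (\<lambda>(i, j).
     if i = j then - (\<Sum>v\<in>{1..N} - {Suc i}. laplacian_offdiag G (Suc i) v)
     else laplacian_offdiag G (Suc i) (Suc j))"

definition grounded_laplacian :: "nat \<Rightarrow> nat pair_pre_digraph \<Rightarrow> nat set \<Rightarrow> real mat" where
  "grounded_laplacian N G S =
     submatrix (laplacian N G) {i. Suc i \<notin> S} {i. Suc i \<notin> S}"

definition sorted_eigvals :: "real mat \<Rightarrow> real list" where
  "sorted_eigvals M = sorted_list_of_multiset (proots (char_poly M))"

text \<open>
  The \<open>k\<close>-th smallest eigenvalue, with \<open>k\<close> counted from \<open>1\<close>.  It is meaningful for
  \<open>1 \<le> k \<le> n\<close> and symmetric \<open>M\<close> of size \<open>n\<close>; then all \<open>n\<close> roots of the characteristic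
  polynomial are real, as shown in \<open>length_sorted_eigvals\<close> below.
\<close>

definition eigval :: "nat \<Rightarrow> real mat \<Rightarrow> real" where
  "eigval k M = sorted_eigvals M ! (k - 1)"

lemma real_eigenvalue_symmetric:
  fixes M :: "real mat"
  assumes M: "M \<in> carrier_mat n n" and sym: "transpose_mat M = M"
    and ev: "eigenvalue (map_mat complex_of_real M) e"
  shows "e \<in> \<real>"
proof -
  let ?C = "map_mat complex_of_real M"
  have C: "?C \<in> carrier_mat n n" using M by simp
  have symC: "transpose_mat ?C = ?C"
    using arg_cong[OF sym, of "map_mat complex_of_real"] by (simp add: map_mat_transpose)
  obtain v where v: "v \<in> carrier_vec n" "v \<noteq> 0\<^sub>v n" and eq: "?C *\<^sub>v v = e \<cdot>\<^sub>v v"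
    using ev M unfolding eigenvalue_def eigenvector_def by auto
  have conj: "conjugate (?C *\<^sub>v v) = ?C *\<^sub>v conjugate v"
    by (rule eq_vecI) (use M v in \<open>auto simp: scalar_prod_def\<close>)
  have "e * (v \<bullet>c v) = (?C *\<^sub>v v) \<bullet>c v" using v eq by simp
  also have "\<dots> = v \<bullet> (?C *\<^sub>v conjugate v)"
    using transpose_vec_mult_scalar[OF C, of "conjugate v" v] v symC C
    by (simp add: comm_scalar_prod[of _ n])
  also have "\<dots> = v \<bullet>c (e \<cdot>\<^sub>v v)" using conj eq by simp
  also have "\<dots> = cnj e * (v \<bullet>c v)" using v by (simp add: conjugate_smult_vec)
  finally have "e = cnj e" using v conjugate_square_eq_0_vec[OF v(1)] by auto
  thus ?thesis by (simp add: Reals_cnj_iff)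
qed

lemma length_sorted_eigvals:
  assumes M: "M \<in> carrier_mat n n" and sym: "transpose_mat M = M"
  shows "length (sorted_eigvals M) = n"
proof -
  interpret h: inj_comm_ring_hom complex_of_real by unfold_locales auto
  interpret hp: map_poly_inj_comm_ring_hom complex_of_real ..
  let ?C = "map_mat complex_of_real M"
  have C: "?C \<in> carrier_mat n n" using M by simp
  obtain as where as: "char_poly ?C = (\<Prod>a\<leftarrow>as. [:- a, 1:])" and len: "length as = n"
    using char_poly_factorized[OF C] by blast
  have "a \<in> \<real>" if "a \<in> set as" for a
  proof (rule real_eigenvalue_symmetric[OF M sym])
    show "eigenvalue ?C a"
      using that unfolding eigenvalue_root_char_poly[OF C] as poly_prod_list
      by (auto simp: prod_list_zero_iff)
  qed
  hence as_Re: "as = map complex_of_real (map Re as)"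
    by (simp add: map_idI)
  have *: "map_poly complex_of_real (\<Prod>a\<leftarrow>bs. [:- a, 1:]) = (\<Prod>a\<leftarrow>map complex_of_real bs. [:- a, 1:])"
    for bs by (induction bs) (simp_all add: hp.hom_mult del: mult_pCons_left)
  have "map_poly complex_of_real (char_poly M)
      = map_poly complex_of_real (\<Prod>a\<leftarrow>map Re as. [:- a, 1:])"
    using as as_Re * of_real_hom.char_poly_hom[OF M] by metis
  hence cp: "char_poly M = (\<Prod>a\<leftarrow>map Re as. [:- a, 1:])" by simp
  have ne: "(\<Prod>a\<leftarrow>bs. [:- a, 1:]) \<noteq> (0 :: real poly)" for bs
    by (induction bs) (simp_all del: mult_pCons_left)
  have "proots (\<Prod>a\<leftarrow>bs. [:- a, 1:]) = mset bs" for bs :: "real list"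
  proof (induction bs)
    case (Cons b bs)
    have "[:- b, 1:] \<noteq> 0" by simp
    from proots_mult[OF this ne[of bs]] Cons show ?case
      by (simp del: mult_pCons_left)
  qed simp
  hence "sorted_eigvals M = sort (map Re as)"
    unfolding sorted_eigvals_def cp by (metis sorted_list_of_multiset_mset)
  thus ?thesis using len by simp
qed

lemma laplacian_carrier: "laplacian N G \<in> carrier_mat N N"
  by (simp add: laplacian_def)

lemma laplacian_symmetric:
  assumes "pair_graph G"
  shows "transpose_mat (laplacian N G) = laplacian N G"
proof -
  interpret pair_graph G by fact
  show ?thesis
    by (rule eq_matI) (auto simp: laplacian_def laplacian_offdiag_def dest: arcs_symmetric)
qed

lemma grounded_laplacian_carrier:
  assumes "S \<subseteq> {1..N}"
  shows "grounded_laplacian N G S \<in> carrier_mat (N - card S) (N - card S)"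
proof -
  have "Suc ` {i. i < N \<and> Suc i \<notin> S} = {1..N} - S"
    by (auto simp: image_iff) (metis Suc_le_eq Suc_pred')
  hence "card {i. i < N \<and> Suc i \<notin> S} = card ({1..N} - S)"
    by (metis card_image inj_Suc)
  also have "\<dots> = N - card S"
    using assms by (simp add: card_Diff_subset finite_subset)
  finally show ?thesis
    by (auto simp: grounded_laplacian_def dim_submatrix laplacian_def)
qed

lemma grounded_laplacian_symmetric:
  assumes "pair_graph G"
  shows "transpose_mat (grounded_laplacian N G S) = grounded_laplacian N G S"
proof -
  let ?I = "{i. Suc i \<notin> S}"
  have sym: "laplacian N G $$ (i, j) = laplacian N G $$ (j, i)" if "i < N" "j < N" for i j
    using arg_cong[OF laplacian_symmetric[OF assms, of N], of "\<lambda>A. A $$ (j, i)"] that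
    by (simp add: laplacian_def)
  have "pick ?I i < N" if "i < card {i. i < N \<and> i \<in> ?I}" for i
    using pick_le[OF that] .
  thus ?thesis
    by (intro eq_matI)
       (auto simp: grounded_laplacian_def submatrix_def laplacian_carrier[THEN carrier_matD(1)]
          laplacian_carrier[THEN carrier_matD(2)] intro: sym)
qed

end

theory Submission
  imports Defs "Jordan_Normal_Form.Schur_Decomposition"
begin

text \<open>
  The inequality is a case of Cauchy interlacing and uses of the Laplacian only that it is real and
  symmetric.  Write \<open>M\<close> for the full matrix, \<open>B\<close> for the principal submatrix left after deleting
  \<open>l\<close> indices, and \<open>\<lambda>\<^sub>1 \<le> \<dots> \<le> \<lambda>\<^sub>n\<close> for the eigenvalues of \<open>M\<close>.
  The eigenvectors of \<open>\<lambda>\<^sub>1, \<dots>, \<lambda>\<^sub>l\<^sub>+\<^sub>1\<close> span a space of dimension \<open>l + 1\<close>, and vanishing at the \<open>l\<close>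
  deleted indices imposes \<open>l\<close> linear conditions on it.  So there is a nonzero \<open>x\<close> in that space
  which is supported on the remaining indices.  Expanding \<open>x\<close> in an orthonormal eigenbasis bounds
  its quadratic form by \<open>x \<bullet> M x \<le> \<lambda>\<^sub>l\<^sub>+\<^sub>1 (x \<bullet> x)\<close> (\<open>rayleigh_test_vector\<close>).  Because of its support,
  \<open>x\<close> has the same norm and the same quadratic form as its restriction \<open>y\<close> has with respect to \<open>B\<close>,
  and the Rayleigh bound \<open>eigval_1_le_rayleigh\<close> for \<open>B\<close> says that
  \<open>eigval 1 B * (y \<bullet> y) \<le> y \<bullet> B y\<close>.  Dividing by the positive number \<open>x \<bullet> x\<close> gives the claim.

  Both bounds rest on \<open>spectral_theorem_real\<close>: a real symmetric matrix is diagonalised by an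
  orthogonal matrix, with the roots of the characteristic polynomial on the diagonal in any
  prescribed order.  The order matters, since the eigenvalues here are the entries of a sorted list.
\<close>

section \<open>The spectral theorem for real symmetric matrices\<close>

text \<open>
  Sorted eigenvalues are defined as roots of the characteristic polynomial, whereas the induction
  in the spectral theorem peels off one linear factor at a time.  Having as many roots as the
  degree leaves no room for a rootless factor, so the two views agree.
\<close>

lemma monic_split_by_roots:
  fixes p :: "real poly"
  assumes "monic p" and "mset es = proots p" and "length es = degree p"
  shows "p = (\<Prod>e\<leftarrow>es. [:- e, 1:])"
  using assms
proof (induction es arbitrary: p)
  case Nil
  then show ?case by (simp add: monic_degree_0)
next
  case (Cons e es)
  have p0: "p \<noteq> 0" using Cons.prems(1) by auto
  have "e \<in># proots p" using Cons.prems(2) by (metis list.set_intros(1) set_mset_mset)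
  hence "poly p e = 0" using p0 by simp
  then obtain q where q: "p = [:- e, 1:] * q" by (auto simp: poly_eq_0_iff_dvd)
  have q0: "q \<noteq> 0" using p0 q by auto
  have "monic q" using Cons.prems(1) unfolding q lead_coeff_mult by simp
  moreover have "proots p = add_mset e (proots q)"
    using proots_mult[of "[:- e, 1:]" q] q0 unfolding q by simp
  hence "mset es = proots q" using Cons.prems(2) by simp
  moreover have "degree p = Suc (degree q)"
    using degree_mult_eq[of "[:- e, 1:]" q] q0 unfolding q by simp
  hence "length es = degree q" using Cons.prems(3) by simp
  ultimately have "q = (\<Prod>e\<leftarrow>es. [:- e, 1:])" by (rule Cons.IH)
  thus ?case using q by simp
qed

lemma char_poly_symmetric:
  fixes M :: "real mat"
  assumes M: "M \<in> carrier_mat n n" and sym: "transpose_mat M = M"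
  shows "char_poly M = (\<Prod>e\<leftarrow>sorted_eigvals M. [:- e, 1:])"
  using degree_monic_char_poly[OF M] length_sorted_eigvals[OF M sym]
  by (intro monic_split_by_roots) (auto simp: sorted_eigvals_def)

text \<open>
  Gram-Schmidt keeps its first vector up to scaling, so a basis that starts with \<open>v\<close> becomes an
  orthonormal one whose first member is still parallel to \<open>v\<close>.
\<close>

lemma orthonormal_completion:
  fixes v :: "real vec"
  assumes v: "v \<in> carrier_vec n" and v0: "v \<noteq> 0\<^sub>v n"
  obtains W r where "W \<in> carrier_mat n n" and "transpose_mat W * W = 1\<^sub>m n"
    and "col W 0 = r \<cdot>\<^sub>v v"
proof -
  interpret cof_vec_space n "TYPE(real)" .
  define b where "b = basis_completion v"
  define ws where "ws = gram_schmidt n b"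
  note b = basis_completion[OF v v0, folded b_def]
  note gs = gram_schmidt_result[OF b(2,4,5) ws_def]
  have len: "length ws = n" using gs(4) b(6) by simp
  have n0: "n > 0" using v v0 by (cases n) auto
  obtain bs where "b = v # bs" using b(6,7) n0 by (cases b) auto
  hence hd: "ws ! 0 = v" using gram_schmidt_hd[OF v, of bs] len n0
    by (metis hd_conv_nth length_greater_0_conv ws_def)
  have c: "ws ! i \<in> carrier_vec n" if "i < n" for i using gs(3) len that by auto
  have conj: "conjugate (ws ! i) = ws ! i" for i by (rule eq_vecI) auto
  have orth: "(ws ! i \<bullet> ws ! j = 0) = (i \<noteq> j)" if "i < n" "j < n" for i j
    using corthogonalD[OF gs(2), of i j] that len conj by simp
  have pos: "ws ! i \<bullet> ws ! i > 0" if "i < n" for i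
    using orth[OF that that] conjugate_square_ge_0_vec[of "ws ! i"] conj[of i] by auto
  define us where "us i = (1 / sqrt (ws ! i \<bullet> ws ! i)) \<cdot>\<^sub>v ws ! i" for i
  have us: "us i \<in> carrier_vec n" if "i < n" for i using c[OF that] by (simp add: us_def)
  have on: "us i \<bullet> us j = (if i = j then 1 else 0)" if "i < n" "j < n" for i j
    using orth[OF that] pos[OF that(1)] c[OF that(1)] c[OF that(2)] by (auto simp: us_def)
  define W where "W = mat_of_cols n (map us [0..<n])"
  have W: "W \<in> carrier_mat n n"
    unfolding W_def by (rule mat_of_cols_carrier(1)[of n "map us [0..<n]", simplified])
  have col: "col W i = us i" if "i < n" for i
    unfolding W_def using us[OF that] that by (subst col_mat_of_cols) auto
  show thesis
  proof (rule that)
    show "W \<in> carrier_mat n n" by fact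
    show "transpose_mat W * W = 1\<^sub>m n"
      by (rule eq_matI) (use W on col in auto)
    show "col W 0 = (1 / sqrt (v \<bullet> v)) \<cdot>\<^sub>v v" using col[OF n0] hd by (simp add: us_def)
  qed
qed

text \<open>
  Matrices of this shape multiply and transpose blockwise, so one induction step of the spectral
  theorem reduces to arithmetic on the two diagonal blocks.
\<close>

definition direct_sum_1 :: "real \<Rightarrow> real mat \<Rightarrow> real mat" where
  "direct_sum_1 e X =
     four_block_mat (mat 1 1 (\<lambda>_. e)) (0\<^sub>m 1 (dim_col X)) (0\<^sub>m (dim_row X) 1) X"

lemma direct_sum_1_carrier:
  "X \<in> carrier_mat m m \<Longrightarrow> direct_sum_1 e X \<in> carrier_mat (Suc m) (Suc m)"
  using four_block_carrier_mat[of "mat 1 1 (\<lambda>_. e)" 1 1 X m m] by (simp add: direct_sum_1_def)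

lemma direct_sum_1_mult:
  assumes X: "X \<in> carrier_mat m m" and Y: "Y \<in> carrier_mat m m"
  shows "direct_sum_1 a X * direct_sum_1 b Y = direct_sum_1 (a * b) (X * Y)"
proof -
  have "mat 1 1 (\<lambda>_. a) * mat 1 1 (\<lambda>_. b) = mat 1 1 (\<lambda>_. a * b)"
    by (rule eq_matI) (auto simp: scalar_prod_def)
  thus ?thesis
    using mult_four_block_mat[of "mat 1 1 (\<lambda>_. a)" 1 1 "0\<^sub>m 1 m" m "0\<^sub>m m 1" m X
        "mat 1 1 (\<lambda>_. b)" 1 "0\<^sub>m 1 m" m "0\<^sub>m m 1" Y] X Y
    by (simp add: direct_sum_1_def)
qed

lemma direct_sum_1_transpose: "transpose_mat (direct_sum_1 e X) = direct_sum_1 e (transpose_mat X)"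
  by (rule eq_matI) (auto simp: direct_sum_1_def)

lemma direct_sum_1_diag:
  "direct_sum_1 (f 0) (mat_diag m (\<lambda>i. f (Suc i))) = mat_diag (Suc m) f"
  by (rule eq_matI) (auto simp: direct_sum_1_def mat_diag_def)

text \<open>
  Symmetry copies the zeros of the first column to the first row, which makes the final form
  diagonal and not merely triangular.
\<close>

lemma symmetric_first_column_splits:
  fixes M :: "real mat"
  assumes M: "M \<in> carrier_mat (Suc m) (Suc m)" and sym: "transpose_mat M = M"
    and col0: "\<And>i. i < Suc m \<Longrightarrow> M $$ (i, 0) = (if i = 0 then e else 0)"
  obtains M' where "M' \<in> carrier_mat m m" and "transpose_mat M' = M'"
    and "M = direct_sum_1 e M'"
proof
  have s: "M $$ (i, j) = M $$ (j, i)" if "i < Suc m" "j < Suc m" for i j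
    using arg_cong[OF sym, of "\<lambda>A. A $$ (j, i)"] that M by simp
  let ?M' = "mat m m (\<lambda>(i, j). M $$ (Suc i, Suc j))"
  show "?M' \<in> carrier_mat m m" by simp
  show "transpose_mat ?M' = ?M'" by (rule eq_matI) (auto intro: s)
  show "M = direct_sum_1 e ?M'"
    by (rule eq_matI) (use M col0 s[of 0] in \<open>auto simp: direct_sum_1_def\<close>)
qed

text \<open>
  Induction on the list of roots.  A change to an orthonormal basis that starts with an eigenvector
  for the first root splits that root off as a \<open>1 \<times> 1\<close> block.  The other block is again symmetric,
  and its characteristic polynomial is the product of the remaining factors, in the same order.
\<close>

theorem spectral_theorem_real:
  fixes A :: "real mat"
  assumes "A \<in> carrier_mat n n" and "transpose_mat A = A"
    and "char_poly A = (\<Prod>e\<leftarrow>es. [:- e, 1:])"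
  shows "\<exists>P \<in> carrier_mat n n. transpose_mat P * P = 1\<^sub>m n
    \<and> transpose_mat P * A * P = mat_diag n ((!) es)"
  using assms
proof (induction es arbitrary: n A)
  case Nil
  hence "n = 0" using degree_monic_char_poly[of A n] by simp
  show ?case
  proof (intro bexI conjI)
    show "1\<^sub>m n \<in> carrier_mat n n" by simp
    show "transpose_mat (1\<^sub>m n) * 1\<^sub>m n = 1\<^sub>m n"
      by (rule eq_matI) (use \<open>n = 0\<close> in auto)
    show "transpose_mat (1\<^sub>m n) * A * 1\<^sub>m n = mat_diag n ((!) [])"
      by (rule eq_matI) (use Nil.prems(1) \<open>n = 0\<close> in \<open>auto simp: mat_diag_def\<close>)
  qed
next
  case (Cons e es)
  note A = Cons.prems(1) and sym = Cons.prems(2) and cp = Cons.prems(3)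
  have "eigenvalue A e" unfolding eigenvalue_root_char_poly[OF A] cp by simp
  then obtain v where v: "v \<in> carrier_vec n" "v \<noteq> 0\<^sub>v n" and ev: "A *\<^sub>v v = e \<cdot>\<^sub>v v"
    using A unfolding eigenvalue_def eigenvector_def by auto
  obtain m where n: "n = Suc m" using v by (cases n) auto
  obtain W r where W: "W \<in> carrier_mat n n" and WW: "transpose_mat W * W = 1\<^sub>m n"
    and col: "col W 0 = r \<cdot>\<^sub>v v"
    using orthonormal_completion[OF v] .
  let ?M = "transpose_mat W * A * W"
  have M: "?M \<in> carrier_mat n n" using A W by simp
  have symM: "transpose_mat ?M = ?M"
    using A W sym by (simp add: transpose_mult[of _ n n _ n] assoc_mult_mat[of _ n n _ n _ n])
  have col0: "?M $$ (i, 0) = (if i = 0 then e else 0)" if i: "i < Suc m" for i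
  proof -
    \<comment> \<open>The first column of \<open>W\<close> is an eigenvector, so \<open>W\<^sup>T A W\<close> maps the first unit vector to \<open>e\<close> times
        the first column of \<open>W\<^sup>T W = 1\<close>.\<close>
    have "A *\<^sub>v col W 0 = e \<cdot>\<^sub>v col W 0"
      using col ev A v by (simp add: smult_smult_assoc mult.commute mult_mat_vec[of A n n])
    hence "col (A * W) 0 = e \<cdot>\<^sub>v col W 0" using col_mult2[OF A W, of 0] n by simp
    hence "?M $$ (i, 0) = e * (transpose_mat W * W) $$ (i, 0)"
      using A W n i by (simp add: assoc_mult_mat[of _ n n _ n _ n])
    thus ?thesis using WW n i by simp
  qed
  obtain A' where A': "A' \<in> carrier_mat m m" "transpose_mat A' = A'"
    and MA': "?M = direct_sum_1 e A'"
    using symmetric_first_column_splits[OF M[unfolded n] symM col0] n by metis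
  have WW': "W * transpose_mat W = 1\<^sub>m n"
    using mat_mult_left_right_inverse[OF _ W WW] W by simp
  have "similar_mat_wit ?M A (transpose_mat W) W"
    by (rule similar_mat_witI[of _ _ n]) (use A W WW WW' in auto)
  hence "char_poly ?M = char_poly A" by (intro char_poly_similar) (auto simp: similar_mat_def)
  moreover have "char_poly ?M = char_poly (mat 1 1 (\<lambda>_. e)) * char_poly A'"
    unfolding MA' direct_sum_1_def using A'(1)
    by (simp only: carrier_matD) (rule char_poly_four_block_zeros_col, auto)
  moreover have "char_poly (mat 1 1 (\<lambda>_. e)) = [:- e, 1:]"
    by (simp add: char_poly_defs det_def sign_def)
  ultimately have "[:- e, 1:] * char_poly A' = [:- e, 1:] * (\<Prod>e\<leftarrow>es. [:- e, 1:])"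
    using cp by simp
  hence "char_poly A' = (\<Prod>e\<leftarrow>es. [:- e, 1:])"
    by (metis mult_cancel_left pCons_eq_0_iff zero_neq_one)
  from Cons.IH[OF A' this] obtain P where P: "P \<in> carrier_mat m m"
    and PP: "transpose_mat P * P = 1\<^sub>m m"
    and D: "transpose_mat P * A' * P = mat_diag m ((!) es)" by blast
  define F where "F = direct_sum_1 1 P"
  have F: "F \<in> carrier_mat n n" using direct_sum_1_carrier[OF P] n by (simp add: F_def)
  have "direct_sum_1 1 (1\<^sub>m m) = 1\<^sub>m n"
    using direct_sum_1_diag[of "\<lambda>_. 1" m] by (simp add: n)
  hence FF: "transpose_mat F * F = 1\<^sub>m n"
    using P PP by (simp add: F_def direct_sum_1_transpose direct_sum_1_mult[of _ m])
  have "transpose_mat F * ?M * F = direct_sum_1 e (transpose_mat P * A' * P)"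
    unfolding MA' F_def direct_sum_1_transpose
    using P A'(1) by (simp add: direct_sum_1_mult[of _ m])
  hence FMF: "transpose_mat F * ?M * F = mat_diag n ((!) (e # es))"
    using direct_sum_1_diag[of "(!) (e # es)" m] D n by simp
  show ?case
  proof (intro bexI conjI)
    show "W * F \<in> carrier_mat n n" using W F by simp
    have "transpose_mat (W * F) * (W * F) = transpose_mat F * ((transpose_mat W * W) * F)"
      using W F by (simp add: transpose_mult[of _ n n _ n] assoc_mult_mat[of _ n n _ n _ n])
    thus "transpose_mat (W * F) * (W * F) = 1\<^sub>m n" using WW F FF by simp
    have "transpose_mat (W * F) * A * (W * F) = transpose_mat F * ?M * F"
      using W F A by (simp add: transpose_mult[of _ n n _ n] assoc_mult_mat[of _ n n _ n _ n])
    thus "transpose_mat (W * F) * A * (W * F) = mat_diag n ((!) (e # es))" using FMF by simp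
  qed
qed

section \<open>Bounds on the Rayleigh quotient\<close>

lemma quadratic_form_eigenbasis:
  fixes A :: "real mat"
  assumes A: "A \<in> carrier_mat n n" and P: "P \<in> carrier_mat n n"
    and D: "transpose_mat P * A * P = mat_diag n d" and c: "c \<in> carrier_vec n"
  shows "(P *\<^sub>v c) \<bullet> (A *\<^sub>v (P *\<^sub>v c)) = (\<Sum>i<n. d i * (c $ i)\<^sup>2)"
proof -
  have "(P *\<^sub>v c) \<bullet> (A *\<^sub>v (P *\<^sub>v c)) = c \<bullet> (transpose_mat P *\<^sub>v (A *\<^sub>v (P *\<^sub>v c)))"
    using transpose_vec_mult_scalar[of "transpose_mat P" n n "A *\<^sub>v (P *\<^sub>v c)" c] A P c by simp
  also have "transpose_mat P *\<^sub>v (A *\<^sub>v (P *\<^sub>v c)) = mat_diag n d *\<^sub>v c"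
    using A P c unfolding D[symmetric] by (simp add: assoc_mult_mat_vec[of _ n n _ n])
  also have "c \<bullet> (mat_diag n d *\<^sub>v c) = (\<Sum>i<n. d i * (c $ i)\<^sup>2)"
    using c
    by (auto simp: scalar_prod_def mat_diag_def power2_eq_square sum.delta if_distrib[of "\<lambda>x. x * _"]
        lessThan_atLeast0 intro!: sum.cong cong: if_cong)
  finally show ?thesis .
qed

text \<open>
  The norm is the quadratic form of the identity matrix, whose eigenvalues are all \<open>1\<close>.
\<close>

lemma norm_eigenbasis:
  fixes P :: "real mat"
  assumes P: "P \<in> carrier_mat n n" and PP: "transpose_mat P * P = 1\<^sub>m n"
    and c: "c \<in> carrier_vec n"
  shows "(P *\<^sub>v c) \<bullet> (P *\<^sub>v c) = (\<Sum>i<n. (c $ i)\<^sup>2)"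
  using quadratic_form_eigenbasis[of "1\<^sub>m n" n P "\<lambda>_. 1" c] P PP c by simp

lemma eigval_mono:
  assumes "M \<in> carrier_mat n n" and "transpose_mat M = M"
    and "1 \<le> i" and "i \<le> j" and "j \<le> n"
  shows "eigval i M \<le> eigval j M"
  using length_sorted_eigvals[OF assms(1,2)] assms(3-)
  by (auto simp: eigval_def intro!: sorted_nth_mono) (simp add: sorted_eigvals_def)

text \<open>
  Matrix indices start at \<open>0\<close> but eigenvalues are counted from \<open>1\<close>, hence the \<open>Suc\<close>.
\<close>

lemma symmetric_eigenbasis:
  fixes M :: "real mat"
  assumes M: "M \<in> carrier_mat n n" and sym: "transpose_mat M = M"
  obtains P where "P \<in> carrier_mat n n" and "transpose_mat P * P = 1\<^sub>m n"
    and "transpose_mat P * M * P = mat_diag n (\<lambda>i. eigval (Suc i) M)"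
proof -
  have "(!) (sorted_eigvals M) = (\<lambda>i. eigval (Suc i) M)" by (simp add: eigval_def fun_eq_iff)
  thus thesis
    using spectral_theorem_real[OF M sym char_poly_symmetric[OF M sym]] that by auto
qed

text \<open>
  In coordinates \<open>c\<close> with respect to the eigenbasis, the form is a combination of the eigenvalues
  with nonnegative weights \<open>c\<^sub>i\<^sup>2\<close>, and the smallest eigenvalue bounds all others from below.
\<close>

lemma eigval_1_le_rayleigh:
  fixes M :: "real mat"
  assumes M: "M \<in> carrier_mat n n" and sym: "transpose_mat M = M" and y: "y \<in> carrier_vec n"
  shows "eigval 1 M * (y \<bullet> y) \<le> y \<bullet> (M *\<^sub>v y)"
proof -
  obtain P where P: "P \<in> carrier_mat n n" and PP: "transpose_mat P * P = 1\<^sub>m n"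
    and D: "transpose_mat P * M * P = mat_diag n (\<lambda>i. eigval (Suc i) M)"
    using symmetric_eigenbasis[OF M sym] .
  define c where "c = transpose_mat P *\<^sub>v y"
  have c: "c \<in> carrier_vec n" using P y by (simp add: c_def)
  have "P * transpose_mat P = 1\<^sub>m n" using mat_mult_left_right_inverse[OF _ P PP] P by simp
  hence yc: "y = P *\<^sub>v c"
    using P y unfolding c_def by (metis assoc_mult_mat_vec one_mult_mat_vec transpose_carrier_mat)
  have "eigval 1 M * (y \<bullet> y) = (\<Sum>i<n. eigval 1 M * (c $ i)\<^sup>2)"
    unfolding yc norm_eigenbasis[OF P PP c] by (rule sum_distrib_left)
  also have "\<dots> \<le> (\<Sum>i<n. eigval (Suc i) M * (c $ i)\<^sup>2)"
    by (intro sum_mono mult_right_mono eigval_mono[OF M sym]) auto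
  also have "\<dots> = y \<bullet> (M *\<^sub>v y)" unfolding yc quadratic_form_eigenbasis[OF M P D c] ..
  finally show ?thesis .
qed

text \<open>
  A row of zeros makes the system square with determinant \<open>0\<close>, so it has a nontrivial kernel.
\<close>

lemma underdetermined_system:
  fixes A :: "real mat"
  assumes A: "A \<in> carrier_mat k (Suc k)"
  obtains c where "c \<in> carrier_vec (Suc k)" and "c \<noteq> 0\<^sub>v (Suc k)" and "A *\<^sub>v c = 0\<^sub>v k"
proof -
  define B where "B = mat\<^sub>r (Suc k) (Suc k) (\<lambda>i. if i = k then 0\<^sub>v (Suc k) else row A i)"
  have B: "B \<in> carrier_mat (Suc k) (Suc k)" by (simp add: B_def)
  have "det B = 0" unfolding B_def by (rule det_row_0) (use A in \<open>auto simp: row_def\<close>)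
  then obtain c where c: "c \<in> carrier_vec (Suc k)" "c \<noteq> 0\<^sub>v (Suc k)" and Bc: "B *\<^sub>v c = 0\<^sub>v (Suc k)"
    using det_0_iff_vec_prod_zero[OF B] by blast
  have "A *\<^sub>v c = 0\<^sub>v k"
  proof (rule eq_vecI)
    fix i assume "i < dim_vec (0\<^sub>v k :: real vec)"
    hence i: "i < k" by simp
    have "row B i = row A i" using i A by (auto simp: B_def intro!: eq_vecI)
    thus "(A *\<^sub>v c) $ i = 0\<^sub>v k $ i"
      using arg_cong[OF Bc, of "\<lambda>v. v $ i"] i A B by simp
  qed (use A in simp)
  thus thesis using c that by blast
qed

text \<open>
  The dimension count of the interlacing argument: the coordinates of \<open>x\<close> along the first
  \<open>card T + 1\<close> eigenvectors are \<open>card T + 1\<close> unknowns subject to \<open>card T\<close> equations \<open>x $ i = 0\<close>.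
  All weights then sit on eigenvalues up to number \<open>card T + 1\<close>, which bounds the quadratic form.
\<close>

lemma rayleigh_test_vector:
  fixes M :: "real mat"
  assumes M: "M \<in> carrier_mat n n" and sym: "transpose_mat M = M"
    and T: "T \<subseteq> {..<n}" and less: "card T < n"
  obtains x where "x \<in> carrier_vec n" and "x \<bullet> x > 0" and "\<And>i. i \<in> T \<Longrightarrow> x $ i = 0"
    and "x \<bullet> (M *\<^sub>v x) \<le> eigval (card T + 1) M * (x \<bullet> x)"
proof -
  obtain P where P: "P \<in> carrier_mat n n" and PP: "transpose_mat P * P = 1\<^sub>m n"
    and D: "transpose_mat P * M * P = mat_diag n (\<lambda>i. eigval (Suc i) M)"
    using symmetric_eigenbasis[OF M sym] .
  let ?k = "card T"
  have "finite T" using T finite_subset by blast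
  then obtain t where t: "bij_betw t {0..<?k} T" using ex_bij_betw_nat_finite by blast
  let ?Q = "mat ?k (Suc ?k) (\<lambda>(i, j). P $$ (t i, j))"
  obtain a where a: "a \<in> carrier_vec (Suc ?k)" "a \<noteq> 0\<^sub>v (Suc ?k)" and ker: "?Q *\<^sub>v a = 0\<^sub>v ?k"
    using underdetermined_system[OF mat_carrier, of ?k "\<lambda>(i, j). P $$ (t i, j)"] .
  \<comment> \<open>Padding with zeros confines \<open>P c\<close> to the span of the first \<open>card T + 1\<close> eigenvectors.\<close>
  define c where "c = vec n (\<lambda>j. if j \<le> ?k then a $ j else 0)"
  have c: "c \<in> carrier_vec n" by (simp add: c_def)
  have restrict: "(\<Sum>j<n. f j * c $ j) = (\<Sum>j<Suc ?k. f j * a $ j)" for f :: "nat \<Rightarrow> real"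
    by (rule sum.mono_neutral_cong_right) (use less in \<open>auto simp: c_def\<close>)
  show thesis
  proof (rule that)
    show "P *\<^sub>v c \<in> carrier_vec n" using P c by simp
    obtain j where j: "j < Suc ?k" "a $ j \<noteq> 0"
      using a by (metis carrier_vecD eq_vecI index_zero_vec)
    hence "(c $ j)\<^sup>2 > 0" "j < n" using less by (auto simp: c_def)
    thus "(P *\<^sub>v c) \<bullet> (P *\<^sub>v c) > 0"
      unfolding norm_eigenbasis[OF P PP c] by (intro sum_pos2[of _ j]) auto
    show "(P *\<^sub>v c) $ i = 0" if "i \<in> T" for i
    proof -
      have i: "i < n" using that T by auto
      have "i \<in> t ` {0..<?k}" using \<open>i \<in> T\<close> bij_betw_imp_surj_on[OF t] by blast
      then obtain s where s: "s < ?k" "t s = i" by auto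
      have "(P *\<^sub>v c) $ i = (\<Sum>j<n. P $$ (i, j) * c $ j)"
        using P c i by (auto simp: scalar_prod_def lessThan_atLeast0)
      also have "\<dots> = (\<Sum>j<Suc ?k. P $$ (i, j) * a $ j)" by (rule restrict)
      also have "\<dots> = (?Q *\<^sub>v a) $ s"
        using s a(1) by (auto simp: scalar_prod_def lessThan_atLeast0 simp del: sum.op_ivl_Suc intro!: sum.cong)
      finally show ?thesis using ker s by simp
    qed
    have "(P *\<^sub>v c) \<bullet> (M *\<^sub>v (P *\<^sub>v c)) = (\<Sum>i<n. eigval (Suc i) M * (c $ i)\<^sup>2)"
      by (rule quadratic_form_eigenbasis[OF M P D c])
    also have "\<dots> \<le> (\<Sum>i<n. eigval (?k + 1) M * (c $ i)\<^sup>2)"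
    proof (rule sum_mono)
      fix i assume "i \<in> {..<n}"
      thus "eigval (Suc i) M * (c $ i)\<^sup>2 \<le> eigval (?k + 1) M * (c $ i)\<^sup>2"
        using eigval_mono[OF M sym, of "Suc i" "?k + 1"] less
        by (cases "i \<le> ?k") (auto simp: c_def intro: mult_right_mono)
    qed
    also have "\<dots> = eigval (?k + 1) M * ((P *\<^sub>v c) \<bullet> (P *\<^sub>v c))"
      unfolding norm_eigenbasis[OF P PP c] by (rule sum_distrib_left[symmetric])
    finally show "(P *\<^sub>v c) \<bullet> (M *\<^sub>v (P *\<^sub>v c)) \<le> eigval (?k + 1) M * ((P *\<^sub>v c) \<bullet> (P *\<^sub>v c))" .
  qed
qed

section \<open>Interlacing for principal submatrices\<close>

text \<open>
  Lets sums over the rows of a submatrix be rewritten as sums over the retained rows of the full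
  matrix.
\<close>

lemma bij_betw_pick:
  "bij_betw (pick I) {..<card {i. i < n \<and> i \<in> I}} {i. i < n \<and> i \<in> I}"
proof -
  let ?J = "{i. i < n \<and> i \<in> I}"
  have p: "pick I i = pick ?J i" if "i < card ?J" for i using pick_reduce_set[OF that] .
  have inj: "inj_on (pick I) {..<card ?J}"
    by (rule linorder_inj_onI) (auto simp: p dest: pick_mono_le[rotated])
  have "pick I i \<in> ?J" if "i < card ?J" for i using pick_in_set_le[OF that] p[OF that] by simp
  hence "pick I ` {..<card ?J} \<subseteq> ?J" by blast
  moreover have "card (pick I ` {..<card ?J}) = card ?J" using inj by (simp add: card_image)
  ultimately have "pick I ` {..<card ?J} = ?J" by (intro card_subset_eq) auto
  thus ?thesis using inj by (simp add: bij_betw_def)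
qed

text \<open>
  The test vector for \<open>M\<close> that vanishes at the deleted indices loses nothing when it is restricted
  to the retained ones, so it can be fed into the lower bound for the submatrix.
\<close>

lemma cauchy_interlacing_smallest:
  fixes M :: "real mat"
  assumes M: "M \<in> carrier_mat n n" and sym: "transpose_mat M = M"
    and less: "card {i. i < n \<and> i \<notin> I} < n"
  shows "eigval 1 (submatrix M I I) \<le> eigval (card {i. i < n \<and> i \<notin> I} + 1) M"
proof -
  let ?T = "{i. i < n \<and> i \<notin> I}" and ?J = "{i. i < n \<and> i \<in> I}"
  let ?B = "submatrix M I I" and ?m = "card {i. i < n \<and> i \<in> I}"
  have B: "?B \<in> carrier_mat ?m ?m" using M by (auto simp: dim_submatrix)
  have bij: "bij_betw (pick I) {..<?m} ?J" by (rule bij_betw_pick)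
  have pick: "pick I i < n" if "i < ?m" for i using bij_betwE[OF bij] that by auto
  have B_index: "?B $$ (i, j) = M $$ (pick I i, pick I j)" if "i < ?m" "j < ?m" for i j
    using M that by (intro submatrix_index) auto
  have "M $$ (i, j) = M $$ (j, i)" if "i < n" "j < n" for i j
    using arg_cong[OF sym, of "\<lambda>A. A $$ (j, i)"] that M by simp
  hence symB: "transpose_mat ?B = ?B"
    by (intro eq_matI) (use B pick B_index in auto)
  have "?T \<subseteq> {..<n}" by auto
  from rayleigh_test_vector[OF M sym this less]
  obtain x where x: "x \<in> carrier_vec n" and xpos: "x \<bullet> x > 0" and x0: "\<And>i. i \<in> ?T \<Longrightarrow> x $ i = 0"
    and le: "x \<bullet> (M *\<^sub>v x) \<le> eigval (card ?T + 1) M * (x \<bullet> x)" by blast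
  define y where "y = vec ?m (\<lambda>i. x $ pick I i)"
  have y: "y \<in> carrier_vec ?m" by (simp add: y_def)
  \<comment> \<open>Sums against \<open>x\<close> see only retained indices.  This one identity transfers the norm, the
      matrix-vector product and the quadratic form from \<open>x\<close> to \<open>y\<close>.\<close>
  have reindex: "(\<Sum>i<?m. f (pick I i) * y $ i) = (\<Sum>i<n. f i * x $ i)" for f :: "nat \<Rightarrow> real"
  proof -
    have "(\<Sum>i<?m. f (pick I i) * y $ i) = (\<Sum>i<?m. f (pick I i) * x $ pick I i)"
      by (rule sum.cong) (auto simp: y_def)
    also have "\<dots> = (\<Sum>i\<in>?J. f i * x $ i)" by (rule sum.reindex_bij_betw[OF bij])
    also have "\<dots> = (\<Sum>i<n. f i * x $ i)"
      by (rule sum.mono_neutral_left) (use x0 in auto)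
    finally show ?thesis .
  qed
  have yy: "y \<bullet> y = x \<bullet> x"
    using reindex[of "\<lambda>i. x $ i"] x y
    by (simp add: scalar_prod_def lessThan_atLeast0) (simp add: y_def)
  have By: "(?B *\<^sub>v y) $ i = (M *\<^sub>v x) $ pick I i" if i: "i < ?m" for i
    using reindex[of "\<lambda>j. M $$ (pick I i, j)"] x y M B i pick[OF i] B_index[OF i]
    by (simp add: scalar_prod_def lessThan_atLeast0)
  have "y \<bullet> (?B *\<^sub>v y) = (\<Sum>i<?m. (M *\<^sub>v x) $ pick I i * y $ i)"
    using By B by (auto simp: scalar_prod_def lessThan_atLeast0 mult.commute)
  also have "\<dots> = x \<bullet> (M *\<^sub>v x)"
    unfolding reindex using M by (simp add: scalar_prod_def lessThan_atLeast0 mult.commute)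
  finally have "eigval 1 ?B * (x \<bullet> x) \<le> eigval (card ?T + 1) M * (x \<bullet> x)"
    using eigval_1_le_rayleigh[OF B symB y] le yy by simp
  thus ?thesis using xpos by simp
qed

theorem theorem4:
  fixes G :: "nat pair_pre_digraph" and N l :: nat and S :: "nat set"
  assumes "pair_graph G" and "pverts G = {1..N}"
    and "S \<subseteq> pverts G" and "card S = l" and "1 \<le> l" and "l < N"
  shows "eigval 1 (grounded_laplacian N G S) \<le> eigval (l + 1) (laplacian N G)"
proof -
  let ?I = "{i. Suc i \<notin> S}"
  let ?T = "{i. i < N \<and> i \<notin> ?I}"
  \<comment> \<open>Node \<open>v\<close> is row \<open>v - 1\<close>, so the deleted rows are as many as the controlled nodes.\<close>
  have "Suc ` ?T = S"
  proof
    show "S \<subseteq> Suc ` ?T"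
    proof
      fix s assume "s \<in> S"
      moreover have "s \<in> {1..N}" using \<open>s \<in> S\<close> assms(2,3) by blast
      ultimately show "s \<in> Suc ` ?T" by (intro image_eqI[of _ _ "s - 1"]) auto
    qed
  qed auto
  hence "card ?T = l" using assms(4) by (metis card_image inj_Suc)
  moreover have "eigval 1 (submatrix (laplacian N G) ?I ?I) \<le> eigval (card ?T + 1) (laplacian N G)"
    using calculation assms(6)
    by (intro cauchy_interlacing_smallest[OF laplacian_carrier laplacian_symmetric[OF assms(1)]])
      (simp only:)
  ultimately show ?thesis by (simp only: grounded_laplacian_def)
qed

end
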